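(* Let $q$ be a prime power and let $m,t,e$ be positive integers satisfying $mt/2<e<mt$, $\gcd(t,q)=1$ and $\mathrm{ord}(q;(q^m-1)t)=e$. Then $m\mid e$, the integer $s=t/\gcd(e/m,t)$ is an odd prime, and the number of all monic, irreducible polynomials $f(x)\neq x$ in $\mathbb{F}_q[x]$ such that $\deg(f)=m$ and $f(x^t)$ contains an irreducible (over $\mathbb{F}_q$) factor of degree $e$ is equal to $N_q^*(m,(t)_{s'})$.
   Context: $\mathbb{F}_q$ is the finite field with $q$ elements. For coprime positive integers $a,r$, $\mathrm{ord}(a;r)$ denotes the smallest positive integer $n$ such that $r$ divides $a^n-1$. For a positive integer $t$ and a prime $s$, $(t)_s$ is the largest power of $s$ dividing $t$, and $(t)_{s'}=t/(t)_s$. For a positive integer $k$, a polynomial $f\in\mathbb{F}_q[x]$ is called $k$-hyper-irreducible if $f(x^k)$ is irreducible over $\mathbb{F}_q$; $N_q^*(m,k)$ denotes the number of all monic $k$-hyper-irreducible polynomials $f(x)\neq x$ of degree $m$ over $\mathbb{F}_q$. *)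

theory Defs
  imports
    Complex_Main
    "HOL-Number_Theory.Number_Theory"
    "HOL-Computational_Algebra.Computational_Algebra"
begin

definition subst_power :: "'a::comm_semiring_1 poly \<Rightarrow> nat \<Rightarrow> 'a poly" where
  "subst_power f k = pcompose f (monom 1 k)"

definition hyper_irreducible :: "nat \<Rightarrow> 'a::field poly \<Rightarrow> bool" where
  "hyper_irreducible k f \<longleftrightarrow> irreducible (subst_power f k)"

text \<open>For a field \<open>'a\<close> with \<open>q\<close> elements, \<open>N_star TYPE('a) m k\<close> is $N_q^*(m,k)$; it is
  meaningful only for positive \<open>k\<close>.\<close>

definition N_star :: "'a::finite_field itself \<Rightarrow> nat \<Rightarrow> nat \<Rightarrow> nat" where
  "N_star _ m k =
     card {f :: 'a poly. lead_coeff f = 1 \<and> hyper_irreducible k f \<and> f \<noteq> [:0, 1:] \<and> degree f = m}"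

text \<open>For a prime \<open>s\<close> and \<open>t > 0\<close>, \<open>prime_part s t\<close> is $(t)_s$ and \<open>coprime_part s t\<close> is
  $(t)_{s'} = t / (t)_s$.\<close>

definition prime_part :: "nat \<Rightarrow> nat \<Rightarrow> nat" where
  "prime_part s t = s ^ multiplicity s t"

definition coprime_part :: "nat \<Rightarrow> nat \<Rightarrow> nat" where
  "coprime_part s t = t div prime_part s t"

end

theory Submission
  imports "HOL-Library.Cardinality" "HOL-Algebra.Algebraic_Closure_Type" Defs
begin

text \<open>
  Put \<open>Q = q\<^sup>m\<close>. The order of \<open>Q\<close> modulo \<open>(Q - 1) t\<close> is \<open>d = e / m\<close>, the least \<open>n > 0\<close> such that \<open>t\<close>
  divides \<open>(Q\<^sup>n - 1) / (Q - 1)\<close>. A factor \<open>u\<close> of \<open>t\<close> whose prime divisors all divide \<open>Q - 1\<close>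
  contributes a divisor of \<open>u\<close> to \<open>d\<close>, and a prime power \<open>p\<^sup>a\<close> with \<open>p\<close> not dividing \<open>Q - 1\<close>
  contributes a divisor of the even number \<open>p\<^sup>a\<^sup>-\<^sup>1 (p - 1)\<close>. Any common factor of two contributions,
  as well as any proper divisor, costs at least a factor 2, so \<open>t / 2 < d < t\<close> leaves only
  \<open>t = u p\<^sup>a\<close> and \<open>d = u p\<^sup>a\<^sup>-\<^sup>1 (p - 1)\<close> with coprime factors, and \<open>s = p\<close>.

  The two sets of polynomials are then equal. The degree of an element \<open>x\<close> of the algebraic closure
  over the field with \<open>q\<close> elements is read off from the exponents \<open>k\<close> for which \<open>x\<close> to the power
  \<open>q\<^sup>k\<close> is \<open>x\<close> again. Extracting a \<open>p\<^sup>a\<close>-th root of a root of \<open>f(x\<^sup>u)\<close> multiplies its degree by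
  at most \<open>p\<^sup>a\<^sup>-\<^sup>1 (p - 1)\<close>, with equality for a suitable choice. Hence \<open>f(x\<^sup>t)\<close> has a factor of degree
  \<open>e\<close> if and only if a root of \<open>f(x\<^sup>u)\<close> has the maximal degree \<open>m u\<close>.
\<close>

subsection \<open>Geometric sums modulo \<open>t\<close>\<close>

lemma mult_geometric_sum_nat: "(Q - 1) * (\<Sum>i<n. Q ^ i) = Q ^ n - (1::nat)"
proof (cases "Q = 0")
  case False
  then have "int ((Q - 1) * (\<Sum>i<n. Q ^ i)) = int (Q ^ n - 1)"
    using power_diff_1_eq[of "int Q" n] by (simp add: of_nat_diff)
  then show ?thesis by linarith
qed (simp add: power_0_left)

lemma dvd_power_diff_1_mono:
  assumes "k dvd n" "N dvd Q ^ k - (1::nat)"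
  shows "N dvd Q ^ n - 1"
proof -
  from assms(1) obtain c where "n = k * c" by (rule dvdE)
  then have "Q ^ n - 1 = (Q ^ k - 1) * (\<Sum>i<c. (Q ^ k) ^ i)"
    by (simp add: mult_geometric_sum_nat power_mult del: One_nat_def)
  with assms(2) show ?thesis by simp
qed

lemma geometric_sum_dvd_mono:
  assumes "Q \<ge> (2::nat)" "k dvd n"
  shows "(\<Sum>i<k. Q ^ i) dvd (\<Sum>i<n. Q ^ i)"
proof -
  have "(Q - 1) * (\<Sum>i<k. Q ^ i) dvd (Q - 1) * (\<Sum>i<n. Q ^ i)"
    unfolding mult_geometric_sum_nat using assms(2) by (rule dvd_power_diff_1_mono) simp
  with assms(1) show ?thesis by simp
qed

lemma coprime_dvd_geometric_sum:
  assumes "coprime w (Q - 1)" "w dvd Q ^ n - (1::nat)"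
  shows "w dvd (\<Sum>i<n. Q ^ i)"
  using assms mult_geometric_sum_nat[of Q n] by (metis coprime_dvd_mult_right_iff)

text \<open>Induction strips one prime \<open>p\<close> off \<open>t = p * u\<close>. Since
  \<open>p\<close> divides \<open>Q ^ u - 1\<close>, the \<open>p\<close> terms of the geometric sum
  in \<open>Q ^ u\<close> are all 1 modulo \<open>p\<close>, so their sum supplies the missing
  factor \<open>p\<close>.\<close>

lemma mult_dvd_power_diff_1:
  assumes "Q > (0::nat)" "t > 0" "\<And>p. prime p \<Longrightarrow> p dvd t \<Longrightarrow> p dvd Q - 1"
  shows "(Q - 1) * t dvd Q ^ t - 1"
  using assms(2,3)
proof (induction t rule: less_induct)
  case (less t)
  show ?case
  proof (cases "t = 1")
    case False
    then obtain p where p: "prime p" "p dvd t" using prime_factor_nat by blast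
    then obtain u where u: "t = p * u" by (elim dvdE)
    then have "u > 0" "u < t" using less.prems(1) prime_gt_1_nat[OF p(1)] by auto
    with less.IH[of u] less.prems u have IH: "(Q - 1) * u dvd Q ^ u - 1" by auto
    have "p dvd Q ^ u - 1"
      using less.prems(2)[OF p] IH by (meson dvd_mult_left dvd_trans)
    then have "[Q ^ u = 1] (mod p)"
      using assms(1) by (subst cong_altdef_nat) (simp_all add: Suc_le_eq)
    then have "[(\<Sum>i<p. (Q ^ u) ^ i) = (\<Sum>i<p. 1 ^ i)] (mod p)"
      by (intro cong_sum cong_pow)
    then have "p dvd (\<Sum>i<p. (Q ^ u) ^ i)"
      by (simp add: cong_def mod_eq_0_iff_dvd)
    with IH have "((Q - 1) * u) * p dvd (Q ^ u - 1) * (\<Sum>i<p. (Q ^ u) ^ i)"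
      by (rule mult_dvd_mono)
    also have "(Q ^ u - 1) * (\<Sum>i<p. (Q ^ u) ^ i) = Q ^ t - 1"
      by (simp only: u mult.commute[of p] power_mult mult_geometric_sum_nat)
    finally show ?thesis by (simp add: u mult_ac)
  qed auto
qed

text \<open>Pigeonhole on the sums with 0 to \<open>u\<close> terms: if those with
  \<open>i < j\<close> terms agree modulo \<open>u\<close>, they differ by \<open>Q ^ i\<close>
  times the sum with \<open>j - i\<close> terms, and \<open>Q ^ i\<close> is invertible modulo
  \<open>u\<close>.\<close>

lemma ex_dvd_geometric_sum:
  assumes "u > 0" "coprime u (Q::nat)"
  obtains E where "0 < E" "E \<le> u" "u dvd (\<Sum>i<E. Q ^ i)"
proof -
  let ?S = "\<lambda>n. \<Sum>i<n. Q ^ i"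
  have "(\<lambda>n. ?S n mod u) ` {..u} \<subseteq> {..<u}" using assms by auto
  then have "card ((\<lambda>n. ?S n mod u) ` {..u}) \<le> card {..<u}"
    by (intro card_mono) auto
  then have "card ((\<lambda>n. ?S n mod u) ` {..u}) < card {..u}" by simp
  then have "\<not> inj_on (\<lambda>n. ?S n mod u) {..u}" by (rule pigeonhole)
  then obtain i j where ij: "i < j" "j \<le> u" "?S i mod u = ?S j mod u"
    unfolding inj_on_def by (metis atMost_iff linorder_neqE_nat)
  have "?S j = ?S i + (\<Sum>k<j - i. Q ^ (i + k))"
    using ij(1) sum.atLeastLessThan_concat[of 0 i j "(^) Q"]
      sum.shift_bounds_nat_ivl[of "(^) Q" 0 i "j - i"]
    by (simp add: atLeast0LessThan add.commute)
  then have "?S j = ?S i + Q ^ i * ?S (j - i)"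
    by (simp add: power_add sum_distrib_left)
  then have "[?S i + Q ^ i * ?S (j - i) = ?S i + 0] (mod u)"
    using ij(3) by (simp add: cong_def)
  then have "u dvd Q ^ i * ?S (j - i)"
    by (simp only: cong_add_lcancel_nat cong_0_iff)
  then have "u dvd ?S (j - i)"
    using assms(2) by (simp add: coprime_dvd_mult_right_iff)
  with ij show ?thesis by (intro that[of "j - i"]) auto
qed

lemma totient_dvd_imp_dvd_power_diff_1:
  assumes "coprime (Q::nat) w" "totient w dvd n"
  shows "w dvd Q ^ n - 1"
proof (rule dvd_power_diff_1_mono[OF assms(2)])
  show "w dvd Q ^ totient w - 1"
    using euler_theorem[OF assms(1)] by (metis cong_to_1_nat)
qed

text \<open>Here \<open>d\<close> is the order of \<open>Q\<close> modulo \<open>(Q - 1) t\<close>, expressed through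
  \<open>(Q\<^sup>n - 1) / (Q - 1)\<close>.\<close>

lemma appearance_order_structure:
  fixes Q t d :: nat
  assumes Q: "Q \<ge> 2" and t: "t > 0" and cop: "coprime t Q"
    and d: "\<And>n. t dvd (\<Sum>i<n. Q ^ i) \<longleftrightarrow> d dvd n"
    and bounds: "d < t" "t < 2 * d"
  obtains p a u where "prime p" "odd p" "a > 0" "\<not> p dvd u" "u > 0" "t = u * p ^ a"
    "d = u * totient (p ^ a)" "coprime u (totient (p ^ a))"
    "\<And>r. prime r \<Longrightarrow> r dvd u \<Longrightarrow> r dvd Q - 1"
    "\<And>k. p ^ a dvd Q ^ k - 1 \<Longrightarrow> totient (p ^ a) dvd k"
proof -
  let ?S = "\<lambda>n. \<Sum>i<n. Q ^ i"
  have half: "2 * x \<le> y" if "x dvd y" "x \<noteq> y" "y > 0" for x y :: nat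
  proof -
    from that(1) obtain k where "y = x * k" by (rule dvdE)
    with that have "k \<noteq> 0" "k \<noteq> 1" by auto
    then have "2 \<le> k" by simp
    then show ?thesis using \<open>y = x * k\<close> mult_le_mono2[of 2 k x] by simp
  qed
  have odd_new: "odd r" if r: "prime r" "r dvd t" "\<not> r dvd Q - 1" for r
  proof
    assume "even r"
    with r have "r = 2" using primes_dvd_imp_eq[of 2 r] by auto
    then have "odd Q" using cop r by (metis coprime_common_divisor not_prime_unit)
    with \<open>r = 2\<close> r Q show False by auto
  qed
  \<comment> \<open>Coprime parts of \<open>t\<close> are treated separately; for \<open>w\<close>
    prime to \<open>Q - 1\<close>, dividing \<open>Q ^ F - 1\<close> is already enough.\<close>
  have glue: "d dvd L" if "t = u * w" "coprime u w" "u dvd ?S E" "E dvd L"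
    "coprime w (Q - 1)" "w dvd Q ^ F - 1" "F dvd L" for u w E F L
  proof -
    have "u dvd ?S L" using that(3) geometric_sum_dvd_mono[OF Q that(4)] by (rule dvd_trans)
    moreover have "w dvd ?S L"
      using that(5) dvd_power_diff_1_mono[OF that(7,6)] by (rule coprime_dvd_geometric_sum)
    ultimately have "t dvd ?S L" unfolding that(1) using that(2) by (rule divides_mult)
    then show ?thesis by (simp add: d)
  qed
  have "\<not> (\<forall>p. prime p \<longrightarrow> p dvd t \<longrightarrow> p dvd Q - 1)"
  proof
    assume "\<forall>p. prime p \<longrightarrow> p dvd t \<longrightarrow> p dvd Q - 1"
    with Q t have "(Q - 1) * t dvd (Q - 1) * ?S t"
      unfolding mult_geometric_sum_nat by (intro mult_dvd_power_diff_1) auto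
    with Q have "d dvd t" by (simp add: d)
    with half[of d t] bounds t show False by auto
  qed
  then obtain p where p: "prime p" "p dvd t" "\<not> p dvd Q - 1" by blast
  define a where "a = multiplicity p t"
  have a: "a > 0" using p t by (simp add: a_def prime_multiplicity_gt_zero_iff)
  obtain u where u: "t = u * p ^ a" "\<not> p dvd u"
    using multiplicity_decompose'[of t p] p t by (metis a_def mult.commute not_prime_unit neq0_conv)
  have "u > 0" using u t by (auto intro: Nat.gr0I)
  note oddp = odd_new[OF p]
  have copu: "coprime u (p ^ a)" using u p by (simp add: coprime_commute prime_imp_coprime)
  have copQ: "coprime (p ^ a) (Q - 1)" using p by (simp add: prime_imp_coprime)
  have copQ': "coprime Q (p ^ a)" using cop u by (simp add: coprime_commute)
  have gt2: "r ^ b > 2" if "prime r" "odd r" "b > 0" for r b :: nat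
  proof -
    have "r > 2" using that prime_ge_2_nat[of r] by (cases "r = 2") auto
    then show ?thesis using that self_le_power[of r b] by linarith
  qed
  have radu: "r dvd Q - 1" if r: "prime r" "r dvd u" for r
  proof (rule ccontr)
    assume nr: "\<not> r dvd Q - 1"
    define b where "b = multiplicity r u"
    have b: "b > 0" using r \<open>u > 0\<close> by (simp add: b_def prime_multiplicity_gt_zero_iff)
    obtain v where v: "u = v * r ^ b" "\<not> r dvd v"
      using multiplicity_decompose'[of u r] r \<open>u > 0\<close>
      by (metis b_def mult.commute not_prime_unit neq0_conv)
    have "r dvd t" using r u by simp
    note oddr = odd_new[OF r(1) this nr]
    have "r \<noteq> p" using r u by auto
    have rp: "coprime (r ^ b) (p ^ a)" using r p \<open>r \<noteq> p\<close> by (simp add: primes_coprime)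
    have "v > 0" using v \<open>u > 0\<close> by (auto intro: Nat.gr0I)
    moreover have "coprime v Q" using cop u v by simp
    ultimately obtain E where E: "0 < E" "E \<le> v" "v dvd ?S E" by (rule ex_dvd_geometric_sum)
    \<comment> \<open>Both totients are even, so half of their product is still a common multiple.
      With \<open>E \<le> v\<close> this gives \<open>2 * d \<le> t\<close>, which rules out a
      second prime \<open>r\<close> not dividing \<open>Q - 1\<close>.\<close>
    define F where "F = totient (r ^ b) * totient (p ^ a) div 2"
    have ev: "even (totient (r ^ b))" "even (totient (p ^ a))"
      using gt2[OF r(1) oddr b] gt2[OF p(1) oddp a] by (auto intro: totient_even)
    then have F: "totient (r ^ b) dvd F" "totient (p ^ a) dvd F"
      unfolding F_def by (auto simp: div_mult_swap dvd_div_mult)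
    have rQ: "coprime Q (r ^ b)" using cop u v by (simp add: coprime_commute)
    have "d dvd E * F"
    proof (rule glue)
      show "t = v * (r ^ b * p ^ a)" using u v by simp
      show "coprime v (r ^ b * p ^ a)"
        using copu v r by (simp add: coprime_commute prime_imp_coprime)
      show "coprime (r ^ b * p ^ a) (Q - 1)" using r nr copQ by (simp add: prime_imp_coprime)
      show "r ^ b * p ^ a dvd Q ^ F - 1"
        using rp F rQ copQ' by (intro divides_mult totient_dvd_imp_dvd_power_diff_1) auto
    qed (use E in auto)
    moreover have "2 * F = totient (r ^ b) * totient (p ^ a)" using ev by (simp add: F_def)
    then have F2: "2 * F \<le> r ^ b * p ^ a" by (simp add: mult_le_mono totient_le)
    moreover have "F > 0"
      using \<open>2 * F = _\<close> r p by (metis mult_is_0 neq0_conv totient_0_iff power_not_zero not_prime_0)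
    ultimately have "d \<le> E * F" using E by (intro dvd_imp_le) auto
    moreover have "2 * (E * F) \<le> t" using mult_le_mono[OF E(2) F2] u v by (simp add: mult_ac)
    ultimately show False using bounds by simp
  qed
  define \<phi> where "\<phi> = totient (p ^ a)"
  have "\<phi> > 0" using p by (simp add: \<phi>_def prime_gt_0_nat)
  have "\<phi> < p ^ a" using gt2[OF p(1) oddp a] by (simp add: \<phi>_def totient_less)
  have "(Q - 1) * u dvd (Q - 1) * ?S u"
    unfolding mult_geometric_sum_nat using Q \<open>u > 0\<close> radu by (intro mult_dvd_power_diff_1) auto
  with Q have Su: "u dvd ?S u" by simp
  have pQ: "p ^ a dvd Q ^ \<phi> - 1"
    using copQ' by (intro totient_dvd_imp_dvd_power_diff_1) (auto simp: \<phi>_def)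
  have u\<phi>: "u * \<phi> \<le> t" using \<open>\<phi> < p ^ a\<close> u by simp
  have "d dvd lcm u \<phi>"
    using glue[OF u(1) copu Su _ copQ pQ] by simp
  moreover have "lcm u \<phi> > 0" using \<open>u > 0\<close> \<open>\<phi> > 0\<close> by (simp add: lcm_pos_nat)
  ultimately have dL: "d \<le> lcm u \<phi>" by (rule dvd_imp_le)
  have cop\<phi>: "coprime u \<phi>"
  proof (rule ccontr)
    assume "\<not> coprime u \<phi>"
    then have "gcd u \<phi> \<noteq> 1" using coprime_iff_gcd_eq_1 by blast
    moreover have "gcd u \<phi> > 0" using \<open>u > 0\<close> by simp
    ultimately have "gcd u \<phi> \<ge> 2" by linarith
    then have "2 * lcm u \<phi> \<le> u * \<phi>"
      unfolding prod_gcd_lcm_nat[of u \<phi>] by (rule mult_le_mono1)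
    with dL u\<phi> bounds show False by linarith
  qed
  then have "d dvd u * \<phi>" using \<open>d dvd lcm u \<phi>\<close> by (simp add: lcm_coprime)
  then have d_eq: "d = u * \<phi>"
    using half[of d "u * \<phi>"] \<open>u > 0\<close> \<open>\<phi> > 0\<close> u\<phi> bounds by auto
  \<comment> \<open>An exponent \<open>k\<close> that works for \<open>p ^ a\<close> makes
    \<open>u * k\<close> a multiple of \<open>d = u * \<phi>\<close>, and \<open>u\<close> cancels:
    \<open>Q\<close> has the full order \<open>\<phi>\<close> modulo \<open>p ^ a\<close>.\<close>
  have main: "\<phi> dvd k" if k: "p ^ a dvd Q ^ k - 1" for k
  proof -
    have "d dvd u * k" by (rule glue[OF u(1) copu Su _ copQ k]) auto
    then show ?thesis using \<open>u > 0\<close> by (simp add: d_eq)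
  qed
  show ?thesis
    by (rule that[of p a u, folded \<phi>_def])
      (fact p oddp a u \<open>u > 0\<close> d_eq cop\<phi> radu main)+
qed

subsection \<open>Roots in the algebraic closure\<close>

lemma map_poly_to_ac_simps [simp]:
  "map_poly to_ac (p + q) = map_poly to_ac p + map_poly to_ac q"
  "map_poly to_ac (p - q) = map_poly to_ac p - map_poly to_ac q"
  "map_poly to_ac (p * q) = map_poly to_ac p * map_poly to_ac q"
  by (rule poly_eqI; simp add: coeff_map_poly coeff_mult to_ac_sum)+

lemma degree_map_poly_to_ac [simp]: "degree (map_poly to_ac p) = degree p"
  by (rule degree_map_poly) simp

lemma map_poly_to_ac_eq_0_iff [simp]: "map_poly to_ac p = 0 \<longleftrightarrow> p = 0"
  by (rule map_poly_eq_0_iff) simp_all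

lemma poly_map_poly_to_ac: "poly (map_poly to_ac p) (to_ac x) = to_ac (poly p x)"
  by (induction p) (simp_all add: map_poly_pCons)

lemma subst_power_pCons: "subst_power (pCons a f) k = [:a:] + monom 1 k * subst_power f k"
  by (simp add: subst_power_def pcompose_pCons)

lemma subst_power_mult: "subst_power (f * g) k = subst_power f k * subst_power g k"
  by (simp add: subst_power_def pcompose_mult)

lemma degree_subst_power: "degree (subst_power (f :: 'a::field poly) k) = degree f * k"
  by (simp add: subst_power_def degree_pcompose degree_monom_eq)

lemma subst_power_eq_0_iff: "k > 0 \<Longrightarrow> subst_power (f :: 'a::field poly) k = 0 \<longleftrightarrow> f = 0"
  by (simp add: subst_power_def pcompose_eq_0_iff degree_monom_eq)

lemma poly_map_subst_power:
  "poly (map_poly to_ac (subst_power f k)) x = poly (map_poly to_ac f) (x ^ k)"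
proof (induction f)
  case (pCons a f)
  then show ?case
    by (simp add: subst_power_pCons map_poly_pCons map_poly_monom poly_monom)
qed (simp add: subst_power_def)

text \<open>Substitution is multiplicative and, by comparing degrees, neither creates nor destroys
  units, so a proper factorization of \<open>f\<close> would carry over.\<close>

lemma irreducible_subst_power_imp:
  fixes f :: "'a::field poly"
  assumes "k > 0" "irreducible (subst_power f k)"
  shows "irreducible f"
proof (rule irreducibleI)
  have unit: "a dvd 1 \<longleftrightarrow> a \<noteq> 0 \<and> degree a = 0" for a :: "'a poly"
    by (metis degree_1 is_unit_iff_degree not_is_unit_0)
  have unit': "subst_power a k dvd 1 \<longleftrightarrow> a dvd 1" for a :: "'a poly"
    using assms(1) by (simp add: unit degree_subst_power subst_power_eq_0_iff)
  show "f \<noteq> 0" using assms by (auto simp: subst_power_def)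
  show "\<not> f dvd 1" using assms unit'[of f] by (auto simp: irreducible_def)
  show "a dvd 1 \<or> b dvd 1" if "f = a * b" for a b
    using irreducibleD[OF assms(2), of "subst_power a k" "subst_power b k"] that
    by (simp add: subst_power_mult unit')
qed

lemma irreducible_poly_degree_pos:
  fixes g :: "'a::field poly"
  assumes "irreducible g"
  shows "degree g > 0"
  using assms by (metis gr0I irreducible_def is_unit_iff_degree)

lemma irreducible_has_root:
  fixes g :: "'a::field poly"
  assumes "irreducible g"
  obtains x where "poly (map_poly to_ac g) x = 0"
  using alg_closed_imp_poly_has_root[of "map_poly to_ac g"] irreducible_poly_degree_pos[OF assms]
  by auto

text \<open>Least degree among the nonzero polynomials vanishing at \<open>x\<close> suffices:
  remainders modulo such a \<open>g\<close> vanish at \<open>x\<close> too, hence are 0.\<close>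

lemma minimal_polynomial_exists:
  fixes h :: "'a::field poly"
  assumes "h \<noteq> 0" "poly (map_poly to_ac h) x = 0"
  obtains g where "irreducible g" "poly (map_poly to_ac g) x = 0"
    "\<And>f. poly (map_poly to_ac f) x = 0 \<Longrightarrow> g dvd f"
proof -
  let ?P = "\<lambda>g :: 'a poly. g \<noteq> 0 \<and> poly (map_poly to_ac g) x = 0"
  define g where "g = arg_min degree ?P"
  have g: "g \<noteq> 0" "poly (map_poly to_ac g) x = 0"
    using arg_min_natI[of ?P h degree] assms by (auto simp: g_def)
  have min: "degree g \<le> degree f" if "f \<noteq> 0" "poly (map_poly to_ac f) x = 0" for f
    using arg_min_nat_le[of ?P f degree] that by (simp add: g_def)
  have dvd: "g dvd f" if f: "poly (map_poly to_ac f) x = 0" for f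
  proof -
    have "f mod g = f - g * (f div g)" by (simp add: minus_mult_div_eq_mod)
    then have "poly (map_poly to_ac (f mod g)) x = 0" using f g by simp
    with min[of "f mod g"] degree_mod_less'[of g f] g have "f mod g = 0" by force
    then show ?thesis by (simp add: mod_eq_0_iff_dvd)
  qed
  have "irreducible g"
  proof (rule irreducibleI)
    show "\<not> g dvd 1"
    proof
      assume "g dvd 1"
      then have "degree g = 0" using g by (simp add: is_unit_iff_degree)
      then obtain c where "g = [:c:]" by (rule degree_eq_zeroE)
      with g show False by (simp add: map_poly_pCons)
    qed
    fix a b assume ab: "g = a * b"
    then have nz: "a \<noteq> 0" "b \<noteq> 0" and deg: "degree g = degree a + degree b"
      using g by (auto simp: degree_mult_eq)
    from ab g have "poly (map_poly to_ac a) x = 0 \<or> poly (map_poly to_ac b) x = 0" by simp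
    then have "degree b = 0 \<or> degree a = 0" using min nz deg by fastforce
    with nz show "a dvd 1 \<or> b dvd 1" by (auto simp: is_unit_iff_degree)
  qed (fact g)
  with g dvd show ?thesis by (intro that[of g])
qed

text \<open>The minimal polynomial \<open>h\<close> of \<open>x\<close> divides both
  \<open>f\<close> and \<open>g\<close>, and irreducibility of \<open>g\<close> forces
  \<open>g dvd h\<close>.\<close>

lemma irreducible_dvd_iff_root:
  fixes g :: "'a::field poly"
  assumes "irreducible g" "poly (map_poly to_ac g) x = 0"
  shows "g dvd f \<longleftrightarrow> poly (map_poly to_ac f) x = 0"
proof
  assume f: "poly (map_poly to_ac f) x = 0"
  have "g \<noteq> 0" using assms(1) by auto
  then obtain h where h: "irreducible h" "poly (map_poly to_ac h) x = 0"
    "\<And>f. poly (map_poly to_ac f) x = 0 \<Longrightarrow> h dvd f"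
    using assms(2) minimal_polynomial_exists by blast
  have "h dvd f" "h dvd g" by (intro h(3) assms(2) f)+
  moreover have "g dvd h"
    using irreducibleD'[OF assms(1) \<open>h dvd g\<close>] h(1) by (auto simp: irreducible_def)
  ultimately show "g dvd f" by (meson dvd_trans)
qed (use assms in auto)

lemma dvd_same_degree_imp_irreducible:
  fixes f g :: "'a::field poly"
  assumes "irreducible g" "g dvd f" "degree f = degree g" "f \<noteq> 0"
  shows "irreducible f"
proof -
  from assms(2) obtain c where c: "f = g * c" by (rule dvdE)
  with assms have "c dvd 1" by (auto simp: degree_mult_eq is_unit_iff_degree)
  with c assms(1) show ?thesis by (simp add: irreducible_mult_unit_left mult.commute[of g])
qed

subsection \<open>Degrees over a finite field\<close>

lemma poly_vanishing_on_base_field: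
  fixes p :: "'a::finite_field alg_closure poly"
  assumes "\<And>c. poly p (to_ac c) = 0" "degree p < CARD('a)"
  shows "p = 0"
proof (rule poly_eqI_degree[of "range to_ac"])
  have "card (range (to_ac :: 'a \<Rightarrow> _)) = CARD('a)"
    by (rule card_image) (rule inj_to_ac)
  then show "degree p < card (range (to_ac :: 'a \<Rightarrow> _))"
    "degree (0 :: 'a alg_closure poly) < card (range (to_ac :: 'a \<Rightarrow> _))"
    using assms(2) by simp_all
qed (use assms in auto)

lemma card_finite_field_ge_2: "CARD('a::finite_field) \<ge> 2"
proof -
  have "card {0 :: 'a, 1} \<le> CARD('a)" by (intro card_mono) auto
  then show ?thesis by simp
qed

lemma to_ac_power_card: "to_ac c ^ CARD('a) = to_ac (c :: 'a::finite_field)"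
  by (simp add: finite_field_power_card_eq_same flip: to_ac_power)

text \<open>Two rounds of the same argument: \<open>(X + y)\<^sup>q - X\<^sup>q - y\<^sup>q\<close> has degree less than \<open>q\<close> and
  vanishes on the base field, at first only for \<open>y\<close> in the base field and then for every \<open>y\<close>.\<close>

lemma frobenius_add:
  fixes x y :: "'a::finite_field alg_closure"
  shows "(x + y) ^ CARD('a) = x ^ CARD('a) + y ^ CARD('a)"
proof -
  let ?q = "CARD('a)"
  define D where "D y = [:y, 1:] ^ ?q - monom 1 ?q - [:y ^ ?q:]" for y :: "'a alg_closure"
  have q: "?q > 0" using card_finite_field_ge_2[where 'a='a] by simp
  have deg: "degree (D y) < ?q" for y
  proof (rule degree_lessI)
    have d: "degree ([:y, 1:] ^ ?q) = ?q" by (rule degree_linear_power)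
    have c: "coeff ([:y, 1:] ^ ?q) ?q = 1"
      using lead_coeff_power[of "[:y, 1:]" ?q] d by simp
    show "\<forall>k\<ge>?q. coeff (D y) k = 0"
    proof (intro allI impI)
      fix k assume "k \<ge> ?q"
      then show "coeff (D y) k = 0"
        using q c d coeff_eq_0[of "[:y, 1:] ^ ?q" k]
        by (cases "k = ?q") (auto simp: D_def coeff_pCons split: nat.splits)
    qed
  qed (use q in auto)
  have poly_D: "poly (D y) x = (x + y) ^ ?q - x ^ ?q - y ^ ?q" for x y
    by (simp add: D_def poly_monom add.commute)
  have base: "D (to_ac c) = 0" for c
    by (rule poly_vanishing_on_base_field[OF _ deg])
      (simp only: poly_D to_ac_add[symmetric] to_ac_power_card, simp)
  have "D y = 0" for y
  proof (rule poly_vanishing_on_base_field[OF _ deg])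
    fix c
    \<comment> \<open>\<open>poly (D y) x\<close> is symmetric in \<open>x\<close> and
      \<open>y\<close>, so the first round provides the zeros needed for the second.\<close>
    have "poly (D (to_ac c)) y = 0" by (simp add: base)
    then show "poly (D y) (to_ac c) = 0" by (simp add: poly_D algebra_simps)
  qed
  then have "poly (D y) x = 0" by simp
  then show ?thesis by (simp add: poly_D algebra_simps)
qed

lemma frobenius_power_add:
  fixes x y :: "'a::finite_field alg_closure"
  shows "(x + y) ^ (CARD('a) ^ n) = x ^ (CARD('a) ^ n) + y ^ (CARD('a) ^ n)"
proof (induction n)
  case (Suc n)
  then show ?case by (simp add: power_mult frobenius_add mult.commute[of "CARD('a)"])
qed simp

lemma frobenius_power_inj:
  fixes x y :: "'a::finite_field alg_closure"
  assumes "x ^ (CARD('a) ^ n) = y ^ (CARD('a) ^ n)"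
  shows "x = y"
proof -
  have "(x - y) ^ (CARD('a) ^ n) = 0"
    using frobenius_power_add[of "x - y" y n] assms by simp
  then show ?thesis by simp
qed

lemma poly_map_to_ac_frobenius:
  fixes f :: "'a::finite_field poly"
  shows "poly (map_poly to_ac f) (x ^ (CARD('a) ^ n)) = poly (map_poly to_ac f) x ^ (CARD('a) ^ n)"
proof (induction f)
  case (pCons a f)
  have "to_ac a ^ (CARD('a) ^ n) = to_ac a"
    by (simp add: finite_field_power_card_power_eq_same flip: to_ac_power)
  with pCons show ?case by (simp add: map_poly_pCons frobenius_power_add power_mult_distrib)
qed (simp add: power_0_left)

text \<open>The polynomials of degree less than \<open>n = degree g\<close> take \<open>q\<^sup>n\<close> distinct values at \<open>x\<close>, all of
  which are roots of \<open>X\<^sup>q\<^sup>k - X\<close>.\<close>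

lemma degree_le_frobenius_period:
  fixes g :: "'a::finite_field poly"
  assumes g: "irreducible g" "poly (map_poly to_ac g) x = 0"
    and k: "k > 0" "x ^ (CARD('a) ^ k) = x"
  shows "degree g \<le> k"
proof -
  let ?q = "CARD('a)" and ?n = "degree g"
  define h where "h c = (\<Sum>i<?n. monom (c i) i)" for c :: "nat \<Rightarrow> 'a"
  have coeff_h: "coeff (h c) i = (if i < ?n then c i else 0)" for c i
    by (simp add: h_def coeff_sum)
  have deg_h: "degree (h c) < ?n" for c
    using irreducible_poly_degree_pos[OF g(1)] by (intro degree_lessI) (auto simp: coeff_h)
  define F where "F = (\<lambda>c. poly (map_poly to_ac (h c)) x)"
  let ?C = "{..<?n} \<rightarrow>\<^sub>E (UNIV :: 'a set)"
  have "inj_on F ?C"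
  proof (rule inj_onI)
    fix c d assume cd: "c \<in> ?C" "d \<in> ?C" "F c = F d"
    then have "g dvd h c - h d"
      using g by (simp add: irreducible_dvd_iff_root F_def)
    moreover have "degree (h c - h d) < ?n" by (intro degree_diff_less deg_h)
    ultimately have "h c = h d" by (meson divides_degree leD right_minus_eq)
    then have "c i = d i" if "i < ?n" for i
      using coeff_h[of c i] coeff_h[of d i] that by simp
    with cd show "c = d" by (intro PiE_ext) auto
  qed
  then have "card (F ` ?C) = ?q ^ ?n" by (simp add: card_image card_PiE)
  moreover have "F c ^ (?q ^ k) = F c" for c
    unfolding F_def by (subst poly_map_to_ac_frobenius[symmetric]) (simp add: k)
  then have "F ` ?C \<subseteq> {y. poly (monom 1 (?q ^ k) - monom 1 1) y = 0}"
    by (auto simp: poly_monom)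
  moreover have q1: "?q ^ k > 1"
    using card_finite_field_ge_2[where 'a='a] k(1) by (intro one_less_power) auto
  have nz: "monom 1 (?q ^ k) - monom 1 1 \<noteq> (0 :: 'a alg_closure poly)"
    using q1 k(1) by (auto simp: monom_eq_iff')
  moreover have "degree (monom 1 (?q ^ k) - monom 1 1 :: 'a alg_closure poly) \<le> ?q ^ k"
    using q1 by (intro degree_diff_le) (auto simp: degree_monom_eq)
  ultimately have "?q ^ ?n \<le> ?q ^ k"
    using card_poly_roots_bound[OF nz] card_mono[OF poly_roots_finite[OF nz]]
    by (metis (no_types, lifting) order_trans)
  then show ?thesis
    using card_finite_field_ge_2[where 'a='a] by (simp add: power_le_imp_le_exp)
qed

text \<open>Among the \<open>n + 1\<close> powers \<open>x ^ (q ^ i)\<close> with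
  \<open>i \<le> n\<close>, all roots of \<open>g\<close>, two coincide; injectivity of Frobenius
  then gives a period of at most \<open>n = degree g\<close>. No positive period is smaller, so
  \<open>n\<close> is the least one and divides all others.\<close>

lemma frobenius_fixed_iff_degree_dvd:
  fixes g :: "'a::finite_field poly"
  assumes g: "irreducible g" "poly (map_poly to_ac g) x = 0"
  shows "x ^ (CARD('a) ^ k) = x \<longleftrightarrow> degree g dvd k"
proof -
  let ?q = "CARD('a)" and ?n = "degree g"
  let ?fix = "\<lambda>k. x ^ (?q ^ k) = x"
  have "g \<noteq> 0" using g by auto
  have n: "?n > 0" by (rule irreducible_poly_degree_pos[OF g(1)])
  have fix_add: "?fix (j + k) \<longleftrightarrow> ?fix k" if "?fix j" for j k
    using that by (simp add: power_add power_mult)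
  have fix_mult: "?fix (j * k)" if "?fix j" for j k
    using that by (induction k) (simp_all add: power_add power_mult)
  have "(\<lambda>i. x ^ (?q ^ i)) ` {..?n} \<subseteq> {y. poly (map_poly to_ac g) y = 0}"
    using g(2) by (auto simp: poly_map_to_ac_frobenius)
  then have "card ((\<lambda>i. x ^ (?q ^ i)) ` {..?n}) \<le> card {y. poly (map_poly to_ac g) y = 0}"
    using \<open>g \<noteq> 0\<close> by (intro card_mono poly_roots_finite) auto
  also have "\<dots> \<le> ?n"
    using card_poly_roots_bound[of "map_poly to_ac g"] \<open>g \<noteq> 0\<close> by simp
  finally have "\<not> inj_on (\<lambda>i. x ^ (?q ^ i)) {..?n}" by (intro pigeonhole) simp
  then obtain i j where ij: "i < j" "j \<le> ?n" "x ^ (?q ^ i) = x ^ (?q ^ j)"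
    unfolding inj_on_def by (metis atMost_iff linorder_neqE_nat)
  have "x ^ (?q ^ j) = (x ^ (?q ^ (j - i))) ^ (?q ^ i)"
    using ij(1) by (simp flip: power_mult power_add)
  with ij(3) have "?fix (j - i)" by (metis frobenius_power_inj)
  moreover from this have "?n \<le> j - i"
    using degree_le_frobenius_period[OF g, of "j - i"] ij by simp
  ultimately have fix_n: "?fix ?n" using ij by (metis diff_le_self le_antisym le_trans)
  show ?thesis
  proof
    assume "?fix k"
    have "?fix (?n * (k div ?n) + k mod ?n)" using \<open>?fix k\<close> by simp
    then have "?fix (k mod ?n)" using fix_add[OF fix_mult[OF fix_n]] by blast
    then have "\<not> k mod ?n > 0"
      using degree_le_frobenius_period[OF g, of "k mod ?n"] mod_less_divisor[OF n, of k]
      by (metis leD)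
    then show "?n dvd k" by (simp add: mod_eq_0_iff_dvd)
  qed (auto elim!: dvdE intro: fix_mult fix_n)
qed

subsection \<open>Prime power roots of unity\<close>

lemma power_cong_exponent:
  fixes x :: "'a::monoid_mult"
  assumes "x ^ M = 1" "[i = j] (mod M)"
  shows "x ^ i = x ^ j"
proof -
  have "x ^ i = x ^ (i mod M)" for i
    using assms(1) by (metis mult_1_left mult_div_mod_eq power_add power_mult power_one)
  with assms(2) show ?thesis by (metis cong_def)
qed

lemma power_eq_self_iff:
  fixes x :: "'a::field"
  assumes "x \<noteq> 0" "n > 0"
  shows "x ^ n = x \<longleftrightarrow> x ^ (n - 1) = 1"
  using assms power_eq_if[of x n] by auto

text \<open>By Bezout, \<open>z\<close> to the power \<open>gcd n (p ^ a) = p ^ j\<close> is 1, and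
  \<open>j < a\<close> would contradict the last hypothesis.\<close>

lemma power_eq_1_iff_prime_power_dvd:
  fixes z :: "'a::field"
  assumes "prime p" "z ^ (p ^ a) = 1" "z ^ (p ^ (a - 1)) \<noteq> 1"
  shows "z ^ n = 1 \<longleftrightarrow> p ^ a dvd n"
proof
  assume n: "z ^ n = 1"
  show "p ^ a dvd n"
  proof (cases "n = 0")
    case False
    then obtain x y where "n * x = p ^ a * y + gcd n (p ^ a)"
      using bezout_nat by blast
    then have "z ^ (n * x) = z ^ (p ^ a * y) * z ^ gcd n (p ^ a)" by (simp add: power_add)
    then have g: "z ^ gcd n (p ^ a) = 1" using n assms(2) by (simp add: power_mult)
    obtain j where j: "j \<le> a" "gcd n (p ^ a) = p ^ j"
      using divides_primepow_nat[OF assms(1), of "gcd n (p ^ a)" a] by auto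
    have "j = a"
    proof (rule ccontr)
      assume "j \<noteq> a"
      with j have "p ^ j dvd p ^ (a - 1)" by (intro le_imp_power_dvd) simp
      then obtain c where "p ^ (a - 1) = p ^ j * c" by (rule dvdE)
      with g j assms(3) show False by (simp add: power_mult)
    qed
    with j show ?thesis by (metis gcd_dvd1)
  qed simp
next
  assume "p ^ a dvd n"
  then show "z ^ n = 1" using assms(2) by (auto simp: power_mult elim!: dvdE)
qed

text \<open>A root \<open>w\<close> of \<open>1 + X + ... + X^(p-1)\<close> is a \<open>p\<close>-th
  root of unity, and it is not 1 because the value at 1 is \<open>p\<close>, which is nonzero. Any
  root of \<open>w\<close> of order \<open>p ^ (a - 1)\<close> serves as \<open>z\<close>.\<close>

lemma primitive_prime_power_root_exists:
  fixes p a :: nat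
  assumes "prime p" "a > 0" "of_nat p \<noteq> (0 :: 'b::alg_closed_field)"
  obtains z :: "'b::alg_closed_field" where "z ^ (p ^ a) = 1" "z ^ (p ^ (a - 1)) \<noteq> 1"
proof -
  have p: "p > 1" using assms(1) by (rule prime_gt_1_nat)
  then obtain w :: 'b where "(\<Sum>k\<le>p - 1. 1 * w ^ k) = 0"
    using alg_closed[of "p - 1" "\<lambda>_. 1 :: 'b"] by auto
  moreover have "{..p - 1} = {..<p}" using p by auto
  ultimately have w: "(\<Sum>k<p. w ^ k) = 0" by simp
  then have "w \<noteq> 1" using assms(3) by auto
  have "w ^ p = 1" using power_diff_1_eq[of w p] w by simp
  obtain z where z: "z ^ (p ^ (a - 1)) = w"
    using nth_root_exists[of "p ^ (a - 1)" w] p by auto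
  have "z ^ (p ^ a) = (z ^ (p ^ (a - 1))) ^ p"
    using assms(2) by (simp add: power_eq_if[of p a] mult.commute flip: power_mult)
  with z \<open>w ^ p = 1\<close> \<open>w \<noteq> 1\<close> show ?thesis by (intro that[of z]) auto
qed

lemma root_neq_0:
  assumes "poly f 0 \<noteq> 0" "poly (map_poly to_ac f) x = 0"
  shows "x \<noteq> 0"
  using assms poly_map_poly_to_ac[of f 0] by auto

subsection \<open>Roots of \<open>f(x\<^sup>t)\<close>\<close>

context
  fixes q m p a u :: nat
  assumes q: "q = CARD('a::finite_field)" and m: "m > 0" and p: "prime p" "odd p" and a: "a > 0"
    and u: "u > 0" and copq: "coprime q p"
    and copu: "coprime u (totient (p ^ a))"
    and radu: "\<And>r. prime r \<Longrightarrow> r dvd u \<Longrightarrow> r dvd q ^ m - 1"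
    and ordp: "\<And>k. p ^ a dvd (q ^ m) ^ k - 1 \<Longrightarrow> totient (p ^ a) dvd k"
begin

private lemma q_ge_2: "q \<ge> 2"
  unfolding q by (rule card_finite_field_ge_2)

text \<open>Otherwise raising to the power \<open>p ^ (a - 1)\<close> lifts the divisibility to
  \<open>p ^ a\<close>, and \<open>ordp\<close> yields \<open>p - 1 dvd k\<close>. Then
  \<open>p - 1\<close> divides both \<open>u\<close> and \<open>totient (p ^ a)\<close>, forcing
  \<open>p = 2\<close>.\<close>

lemma not_dvd_power_diff_1:
  assumes "k dvd u"
  shows "\<not> p dvd (q ^ m) ^ k - 1"
proof
  let ?R = "(q ^ m) ^ k"
  assume dvd: "p dvd ?R - 1"
  have "(?R - 1) * p ^ (a - 1) dvd ?R ^ (p ^ (a - 1)) - 1"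
  proof (rule mult_dvd_power_diff_1)
    show "r dvd ?R - 1" if "prime r" "r dvd p ^ (a - 1)" for r
      using that p(1) dvd by (metis prime_dvd_power primes_dvd_imp_eq)
  qed (use p q_ge_2 in \<open>auto simp: prime_gt_0_nat\<close>)
  moreover have "p * p ^ (a - 1) dvd (?R - 1) * p ^ (a - 1)" using dvd by (rule mult_dvd_mono) simp
  ultimately have "p * p ^ (a - 1) dvd ?R ^ (p ^ (a - 1)) - 1" by (rule dvd_trans[rotated])
  then have "p ^ a dvd (q ^ m) ^ (k * p ^ (a - 1)) - 1"
    using a by (simp add: power_mult power_eq_if[of p a])
  then have "totient (p ^ a) dvd k * p ^ (a - 1)" by (rule ordp)
  moreover have tot: "totient (p ^ a) = p ^ (a - 1) * (p - 1)"
    using p a by (simp add: totient_prime_power)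
  ultimately have "p - 1 dvd k" using p by (simp add: mult.commute prime_gt_0_nat)
  then have "p - 1 dvd u" using assms by (rule dvd_trans)
  moreover have "p - 1 dvd totient (p ^ a)" by (simp add: tot)
  ultimately have "p - 1 dvd 1" using copu by (meson coprime_common_divisor)
  then have "p = 2" using prime_gt_1_nat[OF p(1)] by simp
  with p show False by simp
qed

text \<open>If \<open>y\<close> is a root of \<open>f(x\<^sup>u)\<close>, it has a \<open>p\<^sup>a\<close>-th root \<open>d\<close> in the field it generates, because
  that field has no nontrivial \<open>p\<close>-th roots of unity; the root \<open>d z\<close> of \<open>f(x\<^sup>t)\<close>, with \<open>z\<close> a
  primitive \<open>p\<^sup>a\<close>-th root of unity, then has the required degree.\<close>

lemma irreducible_subst_imp_factor:
  fixes f :: "'a poly"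
  assumes f: "degree f = m" "poly f 0 \<noteq> 0" and irr: "irreducible (subst_power f u)"
  shows "\<exists>g. irreducible g \<and> g dvd subst_power f (u * p ^ a) \<and> degree g = m * (u * totient (p ^ a))"
proof -
  let ?\<phi> = "totient (p ^ a)"
  have qk: "q ^ k > 0" for k using q_ge_2 by simp
  obtain y where y: "poly (map_poly to_ac (subst_power f u)) y = 0"
    using irreducible_has_root[OF irr] .
  have y_fix: "y ^ (q ^ k) = y \<longleftrightarrow> m * u dvd k" for k
    using frobenius_fixed_iff_degree_dvd[OF irr y] by (simp add: degree_subst_power f q)
  have "y ^ u \<noteq> 0" by (rule root_neq_0[OF f(2)]) (use y in \<open>simp add: poly_map_subst_power\<close>)
  then have "y \<noteq> 0" using u by (auto simp: power_0_left)
  \<comment> \<open>\<open>M\<close> is the order of the multiplicative group of the field generated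
    by \<open>y\<close>; inverting \<open>p ^ a\<close> modulo \<open>M\<close> extracts the root
    \<open>d\<close> as a power of \<open>y\<close>.\<close>
  define M where "M = q ^ (m * u) - 1"
  have yM: "y ^ M = 1"
    using y_fix[of "m * u"] power_eq_self_iff[OF \<open>y \<noteq> 0\<close> qk] by (simp add: M_def)
  have "\<not> p dvd M" using not_dvd_power_diff_1[of u] by (simp add: M_def power_mult)
  then have "coprime (p ^ a) M" using p by (simp add: prime_imp_coprime)
  then obtain w where w: "[p ^ a * w = 1] (mod M)" using cong_solve_coprime_nat[of "p ^ a" M] by auto
  define d where "d = y ^ w"
  have dpa: "d ^ (p ^ a) = y"
    using power_cong_exponent[OF yM w] by (simp add: d_def mult.commute flip: power_mult)
  have "d \<noteq> 0" using \<open>y \<noteq> 0\<close> by (simp add: d_def)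
  have d_fix: "d ^ (q ^ k) = d" if "y ^ (q ^ k) = y" for k
    using that by (metis d_def mult.commute power_mult)
  have "CHAR('a) dvd q" unfolding q by (rule CHAR_dvd_CARD)
  then have "\<not> CHAR('a) dvd p"
    using copq by (metis CHAR_prime coprime_common_divisor not_prime_unit)
  then have "of_nat p \<noteq> (0 :: 'a alg_closure)" by (simp add: of_nat_eq_0_iff_char_dvd)
  then obtain z :: "'a alg_closure" where z: "z ^ (p ^ a) = 1" "z ^ (p ^ (a - 1)) \<noteq> 1"
    using primitive_prime_power_root_exists[OF p(1) a] by blast
  have "z \<noteq> 0" using z p by (auto simp: power_0_left prime_gt_0_nat)
  have z_fix: "z ^ (q ^ k) = z \<longleftrightarrow> p ^ a dvd q ^ k - 1" for k
    using power_eq_1_iff_prime_power_dvd[OF p(1) z] power_eq_self_iff[OF \<open>z \<noteq> 0\<close> qk] by simp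
  define x where "x = d * z"
  have xpa: "x ^ (p ^ a) = y" using z dpa by (simp add: x_def power_mult_distrib)
  have x_fix: "x ^ (q ^ k) = x \<longleftrightarrow> m * (u * ?\<phi>) dvd k" for k
  proof
    assume fixed: "x ^ (q ^ k) = x"
    have yk: "y ^ (q ^ k) = y"
      using fixed xpa by (metis mult.commute power_mult)
    then obtain k' where k': "k = m * k'" "u dvd k'"
      using y_fix[of k] by (metis dvd_def mult.assoc)
    \<comment> \<open>Once \<open>y\<close> is fixed, so is its power \<open>d\<close>; cancelling
      \<open>d\<close> leaves a condition on \<open>z\<close> alone.\<close>
    have "d * z ^ (q ^ k) = d * z"
      using fixed d_fix[OF yk] by (simp add: x_def power_mult_distrib)
    then have "z ^ (q ^ k) = z" using \<open>d \<noteq> 0\<close> by simp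
    then have "p ^ a dvd q ^ k - 1" using z_fix by blast
    then have "p ^ a dvd (q ^ m) ^ k' - 1" by (simp add: k' power_mult)
    then have "?\<phi> dvd k'" by (rule ordp)
    with copu k' have "u * ?\<phi> dvd k'" by (intro divides_mult) auto
    with k' show "m * (u * ?\<phi>) dvd k" by simp
  next
    assume k: "m * (u * ?\<phi>) dvd k"
    then have "m * u dvd k" by (metis dvd_mult_left mult.assoc)
    then have "d ^ (q ^ k) = d" by (intro d_fix) (simp add: y_fix)
    moreover have "?\<phi> dvd k" using k by (metis dvd_mult_right)
    then have "z ^ (q ^ k) = z"
      using copq totient_dvd_imp_dvd_power_diff_1[of q "p ^ a" k] by (simp add: z_fix)
    ultimately show "x ^ (q ^ k) = x" by (simp add: x_def power_mult_distrib)
  qed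
  have root: "poly (map_poly to_ac (subst_power f (u * p ^ a))) x = 0"
  proof -
    have "x ^ (u * p ^ a) = y ^ u" using xpa by (metis mult.commute power_mult)
    then show ?thesis using y by (simp add: poly_map_subst_power)
  qed
  have "subst_power f (u * p ^ a) \<noteq> 0"
    using f m u p by (subst subst_power_eq_0_iff) (auto simp: prime_gt_0_nat)
  then obtain g where g: "irreducible g" "poly (map_poly to_ac g) x = 0"
    "\<And>h. poly (map_poly to_ac h) x = 0 \<Longrightarrow> g dvd h"
    using minimal_polynomial_exists[OF _ root] by blast
  have "degree g dvd k \<longleftrightarrow> m * (u * ?\<phi>) dvd k" for k
    using frobenius_fixed_iff_degree_dvd[OF g(1,2), of k] x_fix[of k] by (simp add: q)
  then have "degree g = m * (u * ?\<phi>)" by (meson dvd_antisym dvd_refl)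
  with g root show ?thesis by blast
qed

text \<open>A root \<open>x\<close> of \<open>f(x\<^sup>t)\<close> has degree at most \<open>totient (p\<^sup>a)\<close> over the field generated by its
  power \<open>y = x\<^sup>p\<^sup>a\<close>, so the degree of \<open>x\<close> forces the largest possible degree for \<open>y\<close>.\<close>

lemma factor_imp_irreducible_subst:
  fixes f g :: "'a poly"
  assumes f: "irreducible f" "degree f = m" "poly f 0 \<noteq> 0"
    and g: "irreducible g" "g dvd subst_power f (u * p ^ a)" "degree g = m * (u * totient (p ^ a))"
  shows "irreducible (subst_power f u)"
proof -
  let ?\<phi> = "totient (p ^ a)"
  have qk: "q ^ k > 0" for k using q_ge_2 by simp
  obtain x where x: "poly (map_poly to_ac g) x = 0" using irreducible_has_root[OF g(1)] .
  have x_fix: "x ^ (q ^ k) = x \<longleftrightarrow> m * (u * ?\<phi>) dvd k" for k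
    using frobenius_fixed_iff_degree_dvd[OF g(1) x] by (simp add: g(3) q)
  define y where "y = x ^ (p ^ a)"
  define z where "z = y ^ u"
  have "poly (map_poly to_ac (subst_power f (u * p ^ a))) x = 0"
    using irreducible_dvd_iff_root[OF g(1) x] g(2) by blast
  then have z: "poly (map_poly to_ac f) z = 0"
    by (simp add: poly_map_subst_power y_def z_def mult.commute flip: power_mult)
  have z_fix: "z ^ (q ^ k) = z \<longleftrightarrow> m dvd k" for k
    using frobenius_fixed_iff_degree_dvd[OF f(1) z] by (simp add: f(2) q)
  have "z \<noteq> 0" using root_neq_0[OF f(3) z] .
  then have nz: "y \<noteq> 0" "x \<noteq> 0"
    using u p by (auto simp: z_def y_def power_0_left prime_gt_0_nat)
  have y: "poly (map_poly to_ac (subst_power f u)) y = 0"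
    using z by (simp add: poly_map_subst_power z_def)
  have sf: "subst_power f u \<noteq> 0" using f u by (subst subst_power_eq_0_iff) auto
  then obtain h where h: "irreducible h" "poly (map_poly to_ac h) y = 0"
    "\<And>f. poly (map_poly to_ac f) y = 0 \<Longrightarrow> h dvd f"
    using minimal_polynomial_exists[OF _ y] by blast
  define D where "D = degree h"
  have y_fix: "y ^ (q ^ k) = y \<longleftrightarrow> D dvd k" for k
    using frobenius_fixed_iff_degree_dvd[OF h(1,2)] by (simp add: D_def q)
  \<comment> \<open>\<open>z = y ^ u\<close> lies in the field with \<open>q ^ m\<close> elements,
    and \<open>(q ^ m - 1) * u\<close> divides \<open>q ^ (m * u) - 1\<close>; hence
    \<open>y\<close> lies in the field with \<open>q ^ (m * u)\<close> elements.\<close>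
  have "z ^ (q ^ m - 1) = 1"
    using z_fix[of m] power_eq_self_iff[OF \<open>z \<noteq> 0\<close> qk] by simp
  then have "y ^ ((q ^ m - 1) * u) = 1" by (simp add: z_def mult.commute flip: power_mult)
  moreover have "(q ^ m - 1) * u dvd (q ^ m) ^ u - 1"
    by (rule mult_dvd_power_diff_1) (use u radu qk in auto)
  ultimately have "y ^ (q ^ (m * u) - 1) = 1"
    by (auto simp: power_mult elim!: dvdE)
  then have "D dvd m * u" using y_fix[of "m * u"] power_eq_self_iff[OF nz(1) qk] by simp
  moreover have "m dvd D"
    unfolding z_fix[symmetric] z_def using y_fix[of D] by (metis dvd_refl mult.commute power_mult)
  ultimately obtain D' where D': "D = m * D'" "D' dvd u" using m by (auto elim!: dvdE)
  \<comment> \<open>\<open>w\<close> is the factor by which the \<open>q ^ D\<close>-th power map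
    moves \<open>x\<close>, a \<open>p ^ a\<close>-th root of unity since \<open>y\<close> is fixed.
    Its power to the geometric sum in \<open>q ^ D\<close> with \<open>?\<phi>\<close> terms is
    \<open>x ^ (q ^ (D * ?\<phi>) - 1)\<close>, and \<open>p ^ a\<close> divides that sum.\<close>
  define w where "w = x ^ (q ^ D - 1)"
  have "y ^ (q ^ D - 1) = 1" using y_fix[of D] power_eq_self_iff[OF nz(1) qk] by simp
  then have w: "w ^ (p ^ a) = 1" by (simp add: w_def y_def mult.commute flip: power_mult)
  have "coprime (p ^ a) (q ^ D - 1)"
    using not_dvd_power_diff_1[OF D'(2)] p by (simp add: D' power_mult prime_imp_coprime)
  moreover have "p ^ a dvd (q ^ D) ^ ?\<phi> - 1"
    using copq by (intro totient_dvd_imp_dvd_power_diff_1) auto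
  ultimately have "p ^ a dvd (\<Sum>i<?\<phi>. (q ^ D) ^ i)" by (rule coprime_dvd_geometric_sum)
  then have "w ^ (\<Sum>i<?\<phi>. (q ^ D) ^ i) = 1" using w by (metis dvd_def power_mult power_one)
  then have "x ^ ((q ^ D - 1) * (\<Sum>i<?\<phi>. (q ^ D) ^ i)) = 1"
    unfolding w_def power_mult[symmetric] .
  then have "x ^ ((q ^ D) ^ ?\<phi> - 1) = 1" by (simp only: mult_geometric_sum_nat)
  then have "x ^ (q ^ (D * ?\<phi>)) = x"
    using power_eq_self_iff[OF nz(2) qk, of "D * ?\<phi>"] by (simp add: power_mult)
  then have "m * (u * ?\<phi>) dvd m * (D' * ?\<phi>)" by (simp add: x_fix D' mult.assoc)
  then have "u dvd D'" using m p by (simp add: prime_gt_0_nat)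
  with D' have "degree h = degree (subst_power f u)"
    by (simp add: D_def[symmetric] degree_subst_power f(2) dvd_antisym)
  with dvd_same_degree_imp_irreducible[OF h(1) h(3)[OF y]] sf show ?thesis by simp
qed

end

section \<open>The value of \<open>s\<close> and the equality of the two sets of polynomials\<close>

lemma irreducible_poly_0_eq_0_imp:
  fixes f :: "'a::field poly"
  assumes "irreducible f" "lead_coeff f = 1" "poly f 0 = 0"
  shows "f = [:0, 1:]"
proof -
  from assms(3) have "[:0, 1:] dvd f" using poly_eq_0_iff_dvd[of f 0] by simp
  then obtain g where g: "f = [:0, 1:] * g" by (rule dvdE)
  with assms(1) have "g dvd 1"
    using irreducibleD[OF assms(1) g] by (auto simp: is_unit_iff_degree)
  then have "g \<noteq> 0" by auto
  with \<open>g dvd 1\<close> have "degree g = 0" by (simp add: is_unit_iff_degree)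
  then obtain c where "g = [:c:]" by (auto elim: degree_eq_zeroE)
  with g assms(2) show ?thesis by (simp split: if_splits)
qed

theorem theorem1p4:
  fixes q m t e :: nat
  assumes "card (UNIV :: 'a::finite_field set) = q"
    and "m > 0" and "t > 0" and "e > 0"
    and "real (m * t) / 2 < real e" and "e < m * t"
    and "gcd t q = 1"
    and "ord ((q ^ m - 1) * t) q = e"
  shows "m dvd e \<and>
    (let s = t div gcd (e div m) t in
       prime s \<and> odd s \<and>
       card {f :: 'a poly. lead_coeff f = 1 \<and> irreducible f \<and> f \<noteq> [:0, 1:] \<and> degree f = m \<and>
               (\<exists>g. irreducible g \<and> g dvd subst_power f t \<and> degree g = e)}
         = N_star TYPE('a) m (coprime_part s t))"
proof -
  have q: "q \<ge> 2" using card_finite_field_ge_2[where 'a='a] assms(1) by simp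
  have Q: "q ^ m \<ge> 2" using q assms(2) self_le_power[of q m] by linarith
  have ord: "(q ^ m - 1) * t dvd q ^ n - 1 \<longleftrightarrow> e dvd n" for n
    using ord_divides[of q n "(q ^ m - 1) * t"] q assms(8)
    by (simp add: cong_altdef_nat Suc_le_eq)
  have "m dvd e"
  proof -
    \<comment> \<open>Modulo \<open>q ^ m - 1\<close> the exponent \<open>e\<close> may be replaced
      by \<open>e mod m\<close>; then \<open>q ^ (e mod m) - 1\<close> is divisible by a larger
      number, so it is 0.\<close>
    have "q ^ m - 1 dvd q ^ e - 1" using ord[of e] by (meson dvd_mult_left dvd_refl)
    then have "[q ^ e = 1] (mod (q ^ m - 1))" using q by (simp add: cong_altdef_nat Suc_le_eq)
    moreover have "[q ^ m = 1] (mod (q ^ m - 1))" using q by (simp add: cong_altdef_nat Suc_le_eq)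
    then have "[(q ^ m) ^ (e div m) * q ^ (e mod m) = 1 ^ (e div m) * q ^ (e mod m)] (mod (q ^ m - 1))"
      by (intro cong_mult cong_pow cong_refl)
    then have "[q ^ e = q ^ (e mod m)] (mod (q ^ m - 1))" by (simp flip: power_mult power_add)
    ultimately have "[q ^ (e mod m) = 1] (mod (q ^ m - 1))" by (metis cong_sym cong_trans)
    then have "q ^ m - 1 dvd q ^ (e mod m) - 1" using q by (simp add: cong_altdef_nat Suc_le_eq)
    moreover have "q ^ (e mod m) < q ^ m" using q assms(2) by (intro power_strict_increasing) auto
    then have "q ^ (e mod m) - 1 < q ^ m - 1" using q by (intro diff_less_mono) (auto simp: Suc_le_eq)
    ultimately have "q ^ (e mod m) - 1 = 0" by (meson dvd_imp_le linorder_not_less neq0_conv)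
    then have "e mod m = 0" using q
      by (metis One_nat_def diff_is_0_eq linorder_not_less neq0_conv one_less_power
          Suc_1 Suc_le_lessD)
    then show ?thesis by (simp add: mod_eq_0_iff_dvd)
  qed
  define d where "d = e div m"
  have e: "e = m * d" using \<open>m dvd e\<close> by (simp add: d_def)
  have "t dvd (\<Sum>i<n. (q ^ m) ^ i) \<longleftrightarrow> d dvd n" for n
  proof -
    have "t dvd (\<Sum>i<n. (q ^ m) ^ i) \<longleftrightarrow> (q ^ m - 1) * t dvd (q ^ m - 1) * (\<Sum>i<n. (q ^ m) ^ i)"
      using Q by simp
    also have "\<dots> \<longleftrightarrow> (q ^ m - 1) * t dvd q ^ (m * n) - 1"
      by (simp only: mult_geometric_sum_nat power_mult)
    also have "\<dots> \<longleftrightarrow> d dvd n"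
      using assms(2) by (simp only: ord e) simp
    finally show ?thesis .
  qed
  moreover have "d < t" using assms(6) by (simp add: e)
  moreover have "t < 2 * d"
  proof -
    have "real (m * t) < real (m * (2 * d))" using assms(5) by (simp add: e)
    then show ?thesis by (simp only: of_nat_less_iff mult_less_cancel1)
  qed
  moreover have "coprime t q" using assms(7) coprime_iff_gcd_eq_1 by blast
  then have "coprime t (q ^ m)" by simp
  ultimately obtain p a u where p: "prime p" "odd p" and a: "a > 0" and pu: "\<not> p dvd u"
    and u: "u > 0" and t: "t = u * p ^ a" and d: "d = u * totient (p ^ a)"
    and copu: "coprime u (totient (p ^ a))"
    and radu: "\<And>r. prime r \<Longrightarrow> r dvd u \<Longrightarrow> r dvd q ^ m - 1"
    and ordp: "\<And>k. p ^ a dvd (q ^ m) ^ k - 1 \<Longrightarrow> totient (p ^ a) dvd k"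
    using appearance_order_structure[OF Q assms(3), of d] by metis
  have copq: "coprime q p" using \<open>coprime t q\<close> a by (simp add: t coprime_commute)
  have p1: "p > 1" using p(1) by (rule prime_gt_1_nat)
  have pa: "p ^ a = p ^ (a - 1) * p" using a by (simp add: power_eq_if[of p a])
  have s: "t div gcd (e div m) t = p"
  proof -
    have "totient (p ^ a) = p ^ (a - 1) * (p - 1)" using p a by (simp add: totient_prime_power)
    \<comment> \<open>\<open>d\<close> and \<open>t\<close> share the factor
      \<open>u * p ^ (a - 1)\<close>, with the consecutive cofactors \<open>p - 1\<close> and
      \<open>p\<close>.\<close>
    then have "gcd d t = u * p ^ (a - 1) * gcd (p - 1) p"
      unfolding d t pa by (simp add: mult.assoc flip: gcd_mult_distrib_nat)
    also have "gcd (p - 1) p = 1"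
      using p1 by (intro coprime_imp_gcd_eq_1 coprime_diff_one_left_nat) simp
    finally have "gcd d t = u * p ^ (a - 1)" by simp
    moreover have "t = u * p ^ (a - 1) * p" by (simp add: t pa)
    ultimately show ?thesis using u p1 by (simp add: d_def)
  qed
  have "multiplicity p t = a"
    using p1 pu t u by (intro multiplicity_eqI) (auto simp: mult.commute)
  then have cp: "coprime_part p t = u"
    using p1 by (simp add: coprime_part_def prime_part_def t)
  note factor = irreducible_subst_imp_factor[OF assms(1)[symmetric] assms(2) p a u copq copu radu ordp]
    factor_imp_irreducible_subst[OF assms(1)[symmetric] assms(2) p a u copq copu radu ordp]
  \<comment> \<open>In both directions \<open>f \<noteq> [:0, 1:]\<close> supplies
    \<open>poly f 0 \<noteq> 0\<close>, since \<open>f\<close> is monic and irreducible; from right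
    to left, irreducibility of \<open>f\<close> is inherited from that of
    \<open>subst_power f u\<close>.\<close>
  have "lead_coeff f = 1 \<and> irreducible f \<and> f \<noteq> [:0, 1:] \<and> degree f = m \<and>
      (\<exists>g. irreducible g \<and> g dvd subst_power f t \<and> degree g = e) \<longleftrightarrow>
    lead_coeff f = 1 \<and> hyper_irreducible u f \<and> f \<noteq> [:0, 1:] \<and> degree f = m" for f :: "'a poly"
    using factor[of f] irreducible_poly_0_eq_0_imp[of f] irreducible_subst_power_imp[OF u, of f]
    unfolding hyper_irreducible_def t e d by blast
  then have "{f :: 'a poly. lead_coeff f = 1 \<and> irreducible f \<and> f \<noteq> [:0, 1:] \<and> degree f = m \<and>
      (\<exists>g. irreducible g \<and> g dvd subst_power f t \<and> degree g = e)} =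
    {f. lead_coeff f = 1 \<and> hyper_irreducible u f \<and> f \<noteq> [:0, 1:] \<and> degree f = m}"
    by blast
  then show ?thesis
    using \<open>m dvd e\<close> p by (simp add: s cp N_star_def)
qed

end
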